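(* Let $f,g:[0,\infty)\to[0,\infty)$ be probability density functions on $[0,\infty)$, with cumulative distribution functions $F(s):=\int_0^s f(u)\,\mathrm{d}u$, $s\in[0,\infty)$, and $G(t):=\int_0^t g(u)\,\mathrm{d}u$, $t\in[0,\infty)$. Let $S:=\inf\{s\in[0,\infty):F(s)=1\}\in(0,\infty]$ and $T:=\inf\{t\in[0,\infty):G(t)=1\}\in(0,\infty]$, with the convention $\inf\emptyset:=\infty$. Assume that $f$ is continuous on $[0,S)$, that $g$ is continuous on $[0,T)$, and that there exist $\delta_1\in(0,S)$ and $\delta_2\in(0,T)$ such that $f(t)\neq0$ for all $t\in(0,\delta_1)$ and $g(t)\neq0$ for all $t\in(0,\delta_2)$. Let $\{W(s,t) : s,t\in[0,\infty)\}$ be a standard Wiener field and let $X(s,t):=\mathrm{e}^{-\frac{s}{2}-\frac{t}{2}}\,W(\mathrm{e}^{s},\mathrm{e}^{t})$, $s,t\in\mathbb{R}$, which is a stationary Ornstein-Uhlenbeck field with parameters $(\frac12,\frac12,1)$. Then the random field $\{U(s,t):(s,t)\in[0,S)\times[0,T)\}$ defined by $$U(s,t):=\sqrt{F(s)(1-F(s))G(t)(1-G(t))}\;X\!\left(\ln\!\left(\frac{F(s)}{1-F(s)}\right),\ln\!\left(\frac{G(t)}{1-G(t)}\right)\right)$$ for $(s,t)\in(0,S)\times(0,T)$, and $U(s,t):=0$ for $s=0$ or $t=0$, is an $(F,G)$-Wiener bridge.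
   Context: A random field $\{Y(s,t):(s,t)\in D\}$, $D\subseteq\mathbb{R}^2$, is a Gauss field if all its finite-dimensional distributions are (possibly degenerate) multivariate normal. It has continuous sample paths almost surely if $\mathbb{P}(\{\omega: D\ni(s,t)\mapsto Y(s,t)(\omega)\text{ is continuous}\})=1$. A standard Wiener field is a zero-mean Gauss field $\{W(s,t):s,t\in[0,\infty)\}$ with continuous sample paths almost surely and $\operatorname{Cov}(W(s_1,t_1),W(s_2,t_2))=\min(s_1,s_2)\min(t_1,t_2)$. A stationary Ornstein-Uhlenbeck field with parameters $(\frac12,\frac12,1)$ is a zero-mean Gauss field $\{X(s,t):s,t\in\mathbb{R}\}$ with continuous sample paths almost surely and $\operatorname{Cov}(X(s_1,t_1),X(s_2,t_2))=\exp\{-\frac12|s_2-s_1|-\frac12|t_2-t_1|\}$. An $(F,G)$-Wiener bridge is a zero-mean Gauss field $\{X^{(F,G)}(s,t):(s,t)\in[0,S)\times[0,T)\}$ with continuous sample paths almost surely and with covariance function $$\operatorname{Cov}(X^{(F,G)}(s_1,t_1),X^{(F,G)}(s_2,t_2))=\big(F(\min(s_1,s_2))-F(s_1)F(s_2)\big)\big(G(\min(t_1,t_2))-G(t_1)G(t_2)\big)$$ for $(s_i,t_i)\in[0,S)\times[0,T)$, $i=1,2$. *)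

theory Defs
  imports "HOL-Probability.Probability"
begin

text \<open>
  A random field is a function \<open>Y :: real \<times> real \<Rightarrow> 'w \<Rightarrow> real\<close> together with an explicit index
  domain \<open>D\<close>; the values of \<open>Y\<close> outside \<open>D\<close> are irrelevant.
\<close>

text \<open>The case \<open>\<sigma> = 0\<close> is the degenerate normal law, i.e. the point mass at \<open>\<mu>\<close>.\<close>

definition normal_law :: "real \<Rightarrow> real \<Rightarrow> real measure" where
  "normal_law \<mu> \<sigma> =
     (if \<sigma> = 0 then return borel \<mu>
      else density lborel (\<lambda>x. ennreal (normal_density \<mu> \<sigma> x)))"

text \<open>
  A possibly degenerate multivariate normal law on \<open>\<real>\<^sup>I\<close>, \<open>I\<close> finite: every linear functional of
  the coordinates has a possibly degenerate univariate normal law.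
\<close>

definition multivariate_normal_law :: "'i set \<Rightarrow> ('i \<Rightarrow> real) measure \<Rightarrow> bool" where
  "multivariate_normal_law I N \<longleftrightarrow>
     finite I \<and> sets N = sets (\<Pi>\<^sub>M i\<in>I. (borel :: real measure)) \<and>
     (\<forall>c. \<exists>\<mu> \<sigma>. 0 \<le> \<sigma> \<and> distr N borel (\<lambda>x. \<Sum>i\<in>I. c i * x i) = normal_law \<mu> \<sigma>)"

definition finite_dim_distr ::
    "'w measure \<Rightarrow> ('i \<Rightarrow> 'w \<Rightarrow> real) \<Rightarrow> 'i set \<Rightarrow> ('i \<Rightarrow> real) measure" where
  "finite_dim_distr M Y I = distr M (\<Pi>\<^sub>M i\<in>I. borel) (\<lambda>\<omega>. \<lambda>i\<in>I. Y i \<omega>)"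

definition gauss_field ::
    "'w measure \<Rightarrow> (real \<times> real) set \<Rightarrow> (real \<times> real \<Rightarrow> 'w \<Rightarrow> real) \<Rightarrow> bool" where
  "gauss_field M D Y \<longleftrightarrow>
     (\<forall>p\<in>D. Y p \<in> borel_measurable M) \<and>
     (\<forall>I\<subseteq>D. finite I \<longrightarrow> multivariate_normal_law I (finite_dim_distr M Y I))"

text \<open>
  Almost sure statements are read through \<open>AE\<close>: the set of \<open>\<omega>\<close> with a continuous path need not
  itself be measurable when \<open>M\<close> is not complete.
\<close>

definition continuous_paths_as ::
    "'w measure \<Rightarrow> (real \<times> real) set \<Rightarrow> (real \<times> real \<Rightarrow> 'w \<Rightarrow> real) \<Rightarrow> bool" where
  "continuous_paths_as M D Y \<longleftrightarrow> (AE \<omega> in M. continuous_on D (\<lambda>p. Y p \<omega>))"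

definition covariance :: "'w measure \<Rightarrow> ('w \<Rightarrow> real) \<Rightarrow> ('w \<Rightarrow> real) \<Rightarrow> real" where
  "covariance M X Y =
     (\<integral>\<omega>. (X \<omega> - (\<integral>\<eta>. X \<eta> \<partial>M)) * (Y \<omega> - (\<integral>\<eta>. Y \<eta> \<partial>M)) \<partial>M)"

definition zero_mean_continuous_gauss_field ::
    "'w measure \<Rightarrow> (real \<times> real) set \<Rightarrow> (real \<times> real \<Rightarrow> 'w \<Rightarrow> real) \<Rightarrow> bool" where
  "zero_mean_continuous_gauss_field M D Y \<longleftrightarrow>
     gauss_field M D Y \<and> (\<forall>p\<in>D. (\<integral>\<omega>. Y p \<omega> \<partial>M) = 0) \<and> continuous_paths_as M D Y"

definition standard_wiener_field :: "'w measure \<Rightarrow> (real \<times> real \<Rightarrow> 'w \<Rightarrow> real) \<Rightarrow> bool" where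
  "standard_wiener_field M W \<longleftrightarrow>
     zero_mean_continuous_gauss_field M ({0..} \<times> {0..}) W \<and>
     (\<forall>s1\<ge>0. \<forall>t1\<ge>0. \<forall>s2\<ge>0. \<forall>t2\<ge>0.
        covariance M (W (s1, t1)) (W (s2, t2)) = min s1 s2 * min t1 t2)"

text \<open>The stationary Ornstein-Uhlenbeck field with parameters \<open>(1/2, 1/2, 1)\<close>.\<close>

definition stationary_ou_field :: "'w measure \<Rightarrow> (real \<times> real \<Rightarrow> 'w \<Rightarrow> real) \<Rightarrow> bool" where
  "stationary_ou_field M X \<longleftrightarrow>
     zero_mean_continuous_gauss_field M UNIV X \<and>
     (\<forall>s1 t1 s2 t2.
        covariance M (X (s1, t1)) (X (s2, t2)) = exp (- (1/2) * \<bar>s2 - s1\<bar> - (1/2) * \<bar>t2 - t1\<bar>))"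

definition pdf_on_halfline :: "(real \<Rightarrow> real) \<Rightarrow> bool" where
  "pdf_on_halfline f \<longleftrightarrow>
     (\<forall>x\<ge>0. 0 \<le> f x) \<and> set_integrable lborel {0..} f \<and> (LINT x:{0..}|lborel. f x) = 1"

text \<open>In \<open>ereal\<close> the infimum of the empty set is \<open>\<infinity>\<close>.\<close>

definition right_endpoint :: "(real \<Rightarrow> real) \<Rightarrow> ereal" where
  "right_endpoint F = Inf (ereal ` {s. 0 \<le> s \<and> F s = 1})"

definition wiener_bridge ::
    "'w measure \<Rightarrow> (real \<Rightarrow> real) \<Rightarrow> (real \<Rightarrow> real) \<Rightarrow> (real \<times> real \<Rightarrow> 'w \<Rightarrow> real) \<Rightarrow> bool" where
  "wiener_bridge M F G Y \<longleftrightarrow>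
     (let D = {s. 0 \<le> s \<and> ereal s < right_endpoint F} \<times> {t. 0 \<le> t \<and> ereal t < right_endpoint G} in
        zero_mean_continuous_gauss_field M D Y \<and>
        (\<forall>(s1, t1)\<in>D. \<forall>(s2, t2)\<in>D.
           covariance M (Y (s1, t1)) (Y (s2, t2)) =
             (F (min s1 s2) - F s1 * F s2) * (G (min t1 t2) - G t1 * G t2)))"

end

theory Submission
  imports Defs
begin

text \<open>
  The logarithms and exponentials cancel: for \<open>0 < s < S\<close> and \<open>0 < t < T\<close>, the value \<open>U (s, t)\<close> is
  \<open>(1 - F s) * (1 - G t) * W (F s / (1 - F s), G t / (1 - G t))\<close>.
  So \<open>U\<close> is \<open>W\<close> evaluated along a continuous map of the index set and multiplied by a continuous
  deterministic weight, as is \<open>X\<close> by definition. Such an operation preserves zero-mean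
  continuous Gauss fields, since a linear combination of values of the new field is a linear
  combination of values of the old one, and it multiplies the covariance by the two weights
  (\<open>gauss_field_weighted_pullback\<close>, \<open>covariance_weighted_pullback\<close>). Both covariance formulas are
  then algebra, using for the bridge that \<open>x \<mapsto> x / (1 - x)\<close> increases on \<open>x < 1\<close>.

  The formula also makes sense on the axes \<open>s = 0\<close> and \<open>t = 0\<close>, where the ratio is \<open>0\<close>: there it
  gives a multiple of the value of \<open>W\<close> on an axis. This agrees with the prescribed value \<open>0\<close> of
  \<open>U\<close> for almost every path: each value of \<open>W\<close> on the axes has zero variance, hence vanishes
  almost surely, and continuity extends this from a countable dense set to all points of the axes
  simultaneously (\<open>gauss_field_vanishes_on_closed\<close>). Thus the path continuity of \<open>U\<close> up to the
  axes comes for free from that of \<open>W\<close>.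

  The formula requires \<open>0 < F s < 1\<close> for \<open>0 < s < S\<close>. The upper bound
  follows from the choice of \<open>S\<close>, as \<open>F\<close> is at most \<open>1\<close>; the lower bound comes
  from the density being nonzero near \<open>0\<close>. The same holds for \<open>G\<close>.
\<close>

section \<open>Gauss fields under reweighting and change of index\<close>

lemma gauss_field_iff_linear_combinations:
  "gauss_field M D Y \<longleftrightarrow>
     (\<forall>p\<in>D. Y p \<in> borel_measurable M) \<and>
     (\<forall>I\<subseteq>D. finite I \<longrightarrow>
        (\<forall>c. \<exists>\<mu> \<sigma>. 0 \<le> \<sigma> \<and> distr M borel (\<lambda>\<omega>. \<Sum>i\<in>I. c i * Y i \<omega>) = normal_law \<mu> \<sigma>))"
proof -
  have "distr (finite_dim_distr M Y I) borel (\<lambda>x. \<Sum>i\<in>I. c i * x i)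
          = distr M borel (\<lambda>\<omega>. \<Sum>i\<in>I. c i * Y i \<omega>)"
    if "\<forall>p\<in>D. Y p \<in> borel_measurable M" "I \<subseteq> D" for I c
  proof -
    have [measurable]: "\<And>i. i \<in> I \<Longrightarrow> Y i \<in> borel_measurable M"
      using that by auto
    show ?thesis
      unfolding finite_dim_distr_def
      by (subst distr_distr) (auto simp: comp_def intro!: arg_cong[of _ _ "distr M borel"] sum.cong)
  qed
  then show ?thesis
    by (auto simp: gauss_field_def multivariate_normal_law_def finite_dim_distr_def)
qed

lemma covariance_cong_AE:
  assumes [measurable]: "A \<in> borel_measurable M" "A' \<in> borel_measurable M"
    "B \<in> borel_measurable M" "B' \<in> borel_measurable M"
    and "AE \<omega> in M. A \<omega> = A' \<omega>" and "AE \<omega> in M. B \<omega> = B' \<omega>"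
  shows "covariance M A B = covariance M A' B'"
proof -
  have "integral\<^sup>L M A = integral\<^sup>L M A'" "integral\<^sup>L M B = integral\<^sup>L M B'"
    using assms by (auto intro: integral_cong_AE)
  moreover have "AE \<omega> in M. (A \<omega> - m) * (B \<omega> - n) = (A' \<omega> - m) * (B' \<omega> - n)" for m n
    using assms(5,6) by eventually_elim simp
  ultimately show ?thesis
    unfolding covariance_def by (auto intro!: integral_cong_AE)
qed

lemma covariance_scale:
  "covariance M (\<lambda>\<omega>. a * A \<omega>) (\<lambda>\<omega>. b * B \<omega>) = a * b * covariance M A B"
proof -
  have "(a * A \<omega> - a * m) * (b * B \<omega> - b * n) = a * b * ((A \<omega> - m) * (B \<omega> - n))" for \<omega> m n
    by (simp add: algebra_simps)
  then show ?thesis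
    by (simp add: covariance_def)
qed

text \<open>
  The index map \<open>h\<close> need not be injective, so the coefficients of all \<open>p\<close> with the same image are
  collected before the normality of \<open>Y\<close> on the finite set \<open>h ` I\<close> is used. The relation between
  \<open>V\<close> and \<open>Y\<close> holds outside one null set for all \<open>p\<close> at once, which is what transfers path
  continuity.
\<close>

lemma gauss_field_weighted_pullback:
  assumes Y: "zero_mean_continuous_gauss_field M D' Y"
    and h: "\<And>p. p \<in> D \<Longrightarrow> h p \<in> D'" "continuous_on D h"
    and c: "continuous_on D c"
    and V: "\<And>p. p \<in> D \<Longrightarrow> V p \<in> borel_measurable M"
    and VY: "AE \<omega> in M. \<forall>p\<in>D. V p \<omega> = c p * Y (h p) \<omega>"
  shows "zero_mean_continuous_gauss_field M D V"
proof -
  have measY: "Y q \<in> borel_measurable M" if "q \<in> D'" for q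
    using Y that by (auto simp: zero_mean_continuous_gauss_field_def gauss_field_def)
  have normY: "\<exists>\<mu> \<sigma>. 0 \<le> \<sigma> \<and> distr M borel (\<lambda>\<omega>. \<Sum>j\<in>J. a j * Y j \<omega>) = normal_law \<mu> \<sigma>"
    if "J \<subseteq> D'" "finite J" for J a
    using Y that
    by (auto simp: zero_mean_continuous_gauss_field_def gauss_field_iff_linear_combinations)
  have "\<exists>\<mu> \<sigma>. 0 \<le> \<sigma> \<and> distr M borel (\<lambda>\<omega>. \<Sum>i\<in>I. a i * V i \<omega>) = normal_law \<mu> \<sigma>"
    if I: "I \<subseteq> D" "finite I" for I a
  proof -
    define b where "b j = (\<Sum>i\<in>{i\<in>I. h i = j}. a i * c i)" for j
    have collect: "(\<Sum>i\<in>I. a i * (c i * Y (h i) \<omega>)) = (\<Sum>j\<in>h ` I. b j * Y j \<omega>)" for \<omega>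
      by (subst sum.image_gen[OF I(2), where g = h])
         (auto simp: b_def sum_distrib_right mult.assoc intro!: sum.cong)
    have [measurable]: "V i \<in> borel_measurable M" if "i \<in> I" for i
      using V subsetD[OF I(1) that] .
    have [measurable]: "Y j \<in> borel_measurable M" if "j \<in> h ` I" for j
      using that measY[OF h(1)[OF subsetD[OF I(1)]]] by blast
    have "AE \<omega> in M. (\<Sum>i\<in>I. a i * V i \<omega>) = (\<Sum>j\<in>h ` I. b j * Y j \<omega>)"
      using VY
    proof eventually_elim
      case (elim \<omega>)
      then have "(\<Sum>i\<in>I. a i * V i \<omega>) = (\<Sum>i\<in>I. a i * (c i * Y (h i) \<omega>))"
        using I by (intro sum.cong) auto
      then show ?case
        by (simp only: collect)
    qed
    then have "distr M borel (\<lambda>\<omega>. \<Sum>i\<in>I. a i * V i \<omega>)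
        = distr M borel (\<lambda>\<omega>. \<Sum>j\<in>h ` I. b j * Y j \<omega>)"
      by (intro distr_cong_AE) auto
    then show ?thesis
      using normY[OF image_subsetI[OF h(1)[OF subsetD[OF I(1)]]] finite_imageI[OF I(2)]] by simp
  qed
  then have "gauss_field M D V"
    using V by (auto simp: gauss_field_iff_linear_combinations)
  moreover have "(\<integral>\<omega>. V p \<omega> \<partial>M) = 0" if "p \<in> D" for p
  proof -
    have "(\<integral>\<omega>. V p \<omega> \<partial>M) = (\<integral>\<omega>. c p * Y (h p) \<omega> \<partial>M)"
      using VY that V measY h by (intro integral_cong_AE) auto
    also have "\<dots> = 0"
      using Y h that by (simp add: zero_mean_continuous_gauss_field_def)
    finally show ?thesis .
  qed
  moreover have "AE \<omega> in M. continuous_on D (\<lambda>p. V p \<omega>)"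
  proof -
    have "AE \<omega> in M. continuous_on D' (\<lambda>p. Y p \<omega>)"
      using Y by (simp add: zero_mean_continuous_gauss_field_def continuous_paths_as_def)
    then show ?thesis
      using VY
    proof eventually_elim
      case (elim \<omega>)
      have "continuous_on D (\<lambda>p. c p * Y (h p) \<omega>)"
        using h by (intro continuous_on_mult c continuous_on_compose2[OF elim(1)]) auto
      then show ?case
        using elim(2) by (simp cong: continuous_on_cong)
    qed
  qed
  ultimately show ?thesis
    by (simp add: zero_mean_continuous_gauss_field_def continuous_paths_as_def)
qed

lemma covariance_weighted_pullback:
  assumes Y: "\<And>q. q \<in> D' \<Longrightarrow> Y q \<in> borel_measurable M"
    and h: "\<And>p. p \<in> D \<Longrightarrow> h p \<in> D'"
    and V: "\<And>p. p \<in> D \<Longrightarrow> V p \<in> borel_measurable M"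
    and VY: "AE \<omega> in M. \<forall>p\<in>D. V p \<omega> = c p * Y (h p) \<omega>"
    and pq: "p \<in> D" "q \<in> D"
  shows "covariance M (V p) (V q) = c p * c q * covariance M (Y (h p)) (Y (h q))"
proof -
  have "covariance M (V p) (V q)
      = covariance M (\<lambda>\<omega>. c p * Y (h p) \<omega>) (\<lambda>\<omega>. c q * Y (h q) \<omega>)"
    using VY pq Y h V by (intro covariance_cong_AE) auto
  then show ?thesis
    by (simp add: covariance_scale)
qed

section \<open>Vanishing of a Gauss field of zero variance\<close>

text \<open>
  The vanishing of the Bochner integral of \<open>(Y p)\<^sup>2\<close> alone would not suffice, as that integral is
  also \<open>0\<close> when \<open>(Y p)\<^sup>2\<close> is not integrable; normality excludes this.
\<close>

lemma gauss_zero_variance_AE_zero: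
  assumes "prob_space M" and "gauss_field M D Y" and "p \<in> D"
    and mean: "(\<integral>\<omega>. Y p \<omega> \<partial>M) = 0" and var: "covariance M (Y p) (Y p) = 0"
  shows "AE \<omega> in M. Y p \<omega> = 0"
proof -
  interpret prob_space M by fact
  have [measurable]: "Y p \<in> borel_measurable M"
    using assms by (auto simp: gauss_field_def)
  have "\<exists>\<mu> \<sigma>. 0 \<le> \<sigma> \<and> distr M borel (\<lambda>\<omega>. \<Sum>i\<in>{p}. 1 * Y i \<omega>) = normal_law \<mu> \<sigma>"
    using assms(2)[unfolded gauss_field_iff_linear_combinations, THEN conjunct2, rule_format,
        of "{p}" "\<lambda>_. 1"] \<open>p \<in> D\<close>
    by auto
  then obtain \<mu> \<sigma> where \<sigma>: "0 \<le> \<sigma>" and law: "distr M borel (Y p) = normal_law \<mu> \<sigma>"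
    by auto
  show ?thesis
  proof (cases "\<sigma> = 0")
    case True
    have "distr M borel (Y p) = return borel \<mu>"
      using law True by (simp add: normal_law_def)
    moreover have "AE x in return borel \<mu>. x = \<mu>"
      by (subst AE_return) auto
    ultimately have "AE x in distr M borel (Y p). x = \<mu>"
      by (simp only:)
    then have const: "AE \<omega> in M. Y p \<omega> = \<mu>"
      by (subst (asm) AE_distr_iff) auto
    then have "(\<integral>\<omega>. Y p \<omega> \<partial>M) = (\<integral>\<omega>. \<mu> \<partial>M)"
      by (intro integral_cong_AE) auto
    then have "\<mu> = 0"
      using mean by (simp add: prob_space)
    with const show ?thesis
      by simp
  next
    case False
    then have "0 < \<sigma>"
      using \<sigma> by simp
    have D: "distributed M lborel (Y p) (normal_density \<mu> \<sigma>)"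
      using law False by (auto simp: distributed_def normal_law_def cong: distr_cong)
    have "\<sigma>\<^sup>2 = 0"
      using normal_distributed_variance[OF \<open>0 < \<sigma>\<close> D] var
      by (simp add: covariance_def power2_eq_square)
    then show ?thesis
      using False by simp
  qed
qed

lemma gauss_field_vanishes_on_closed:
  assumes "prob_space M" and Y: "zero_mean_continuous_gauss_field M D Y"
    and A: "A \<subseteq> D" "closed A"
    and var: "\<And>p. p \<in> A \<Longrightarrow> covariance M (Y p) (Y p) = 0"
  shows "AE \<omega> in M. \<forall>p\<in>A. Y p \<omega> = 0"
proof -
  obtain B where B: "countable B" "B \<subseteq> A" "A \<subseteq> closure B"
    using separable by blast
  then have clB: "closure B = A"
    using A(2) by (simp add: closure_minimal subset_antisym)
  have "AE \<omega> in M. Y p \<omega> = 0" if "p \<in> B" for p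
  proof (rule gauss_zero_variance_AE_zero[OF assms(1)])
    show "p \<in> D" "covariance M (Y p) (Y p) = 0"
      using that B(2) A(1) var by blast+
    then show "gauss_field M D Y" "(\<integral>\<omega>. Y p \<omega> \<partial>M) = 0"
      using Y by (auto simp: zero_mean_continuous_gauss_field_def)
  qed
  then have "AE \<omega> in M. \<forall>p\<in>B. Y p \<omega> = 0"
    using B(1) by (intro AE_ball_countable')
  moreover have "AE \<omega> in M. continuous_on D (\<lambda>p. Y p \<omega>)"
    using Y by (simp add: zero_mean_continuous_gauss_field_def continuous_paths_as_def)
  ultimately show ?thesis
  proof eventually_elim
    case (elim \<omega>)
    have "continuous_on (closure B) (\<lambda>p. Y p \<omega>)"
      using elim(2) A(1) clB by (auto intro: continuous_on_subset)
    then show ?case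
      using continuous_constant_on_closure[of B "\<lambda>p. Y p \<omega>" 0] elim(1) clB by blast
  qed
qed

section \<open>Distribution functions\<close>

lemma pdf_on_halfline_set_integrable:
  assumes "pdf_on_halfline f" and "A \<in> sets borel" and "A \<subseteq> {0..}"
  shows "set_integrable lborel A f"
  using assms by (auto simp: pdf_on_halfline_def intro: set_integrable_subset)

lemma pdf_on_halfline_integral_mono:
  assumes f: "pdf_on_halfline f" and A: "A \<in> sets borel" and B: "B \<in> sets borel"
    and sub: "A \<subseteq> B" "B \<subseteq> {0..}"
  shows "(LINT u:A|lborel. f u) \<le> (LINT u:B|lborel. f u)"
proof -
  have "integrable lborel (\<lambda>u. indicator A u *\<^sub>R f u)" "integrable lborel (\<lambda>u. indicator B u *\<^sub>R f u)"
    using pdf_on_halfline_set_integrable[OF f A] pdf_on_halfline_set_integrable[OF f B] sub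
    by (auto simp: set_integrable_def)
  then show ?thesis
    unfolding set_lebesgue_integral_def
    using f sub
    by (intro integral_mono) (auto simp: pdf_on_halfline_def indicator_def)
qed

text \<open>
  If the integral were \<open>0\<close>, the nonnegative density would vanish almost everywhere on \<open>{0..s}\<close>,
  whereas it is nonzero on an interval of positive length.
\<close>

lemma pdf_on_halfline_integral_pos:
  assumes f: "pdf_on_halfline f" and "0 < \<delta>" "0 < s" and nz: "\<And>u. 0 < u \<Longrightarrow> u < \<delta> \<Longrightarrow> f u \<noteq> 0"
  shows "0 < (LINT u:{0..s}|lborel. f u)"
proof (rule ccontr)
  let ?g = "\<lambda>u. indicator {0..s} u *\<^sub>R f u"
  assume "\<not> ?thesis"
  moreover have nonneg: "0 \<le> ?g u" for u
    using f by (auto simp: pdf_on_halfline_def indicator_def)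
  moreover have "integrable lborel ?g"
    using pdf_on_halfline_set_integrable[OF f, of "{0..s}"] by (auto simp: set_integrable_def)
  ultimately have "AE u in lborel. ?g u = 0"
    by (subst integral_nonneg_eq_0_iff_AE[symmetric])
       (auto simp: set_lebesgue_integral_def intro!: antisym integral_nonneg_AE)
  then have "AE u in lborel. u \<notin> {0<..<min s \<delta>}"
    by eventually_elim (use nz in \<open>force simp: indicator_def\<close>)
  then have "{0<..<min s \<delta>} \<in> null_sets lborel"
    by (simp add: AE_iff_null_sets)
  then show False
    using assms by (auto simp: min_def split: if_splits)
qed

text \<open>
  The odds \<open>F / (1 - F)\<close> are the time change of the bridge. The hypothesis that \<open>f\<close> does not vanish
  near \<open>0\<close> keeps them positive off the axes, where their logarithm is taken.
\<close>

lemma distribution_function_properties: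
  assumes f: "pdf_on_halfline f"
    and F: "\<And>s. 0 \<le> s \<Longrightarrow> F s = (LINT u:{0..s}|lborel. f u)"
    and "0 < \<delta>" and nz: "\<And>u. 0 < u \<Longrightarrow> u < \<delta> \<Longrightarrow> f u \<noteq> 0"
  shows "F 0 = 0"
    and "\<And>s. 0 < s \<Longrightarrow> 0 < F s"
    and "\<And>s. 0 \<le> s \<Longrightarrow> ereal s < right_endpoint F \<Longrightarrow> F s < 1"
    and "\<And>s s'. 0 \<le> s \<Longrightarrow> 0 \<le> s' \<Longrightarrow> F (min s s') = min (F s) (F s')"
    and "continuous_on {0..} F"
proof -
  show "F 0 = 0"
  proof -
    have "AE u in lborel. indicator {0} u *\<^sub>R f u = 0"
      using AE_lborel_singleton[of 0] by eventually_elim simp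
    then show ?thesis
      unfolding F[OF order_refl] set_lebesgue_integral_def
      by (simp add: integral_eq_zero_AE)
  qed
  show "0 < F s" if "0 < s" for s
    using pdf_on_halfline_integral_pos[OF f \<open>0 < \<delta>\<close> that nz] F that by simp
  show "F s < 1" if "0 \<le> s" "ereal s < right_endpoint F" for s
  proof -
    have "F s \<le> 1"
      using pdf_on_halfline_integral_mono[OF f, of "{0..s}" "{0..}"] F that f
      by (auto simp: pdf_on_halfline_def)
    moreover have "F s \<noteq> 1"
    proof
      assume "F s = 1"
      then have "right_endpoint F \<le> ereal s"
        unfolding right_endpoint_def using that(1) by (intro Inf_lower) auto
      with that(2) show False
        by simp
    qed
    ultimately show ?thesis
      by simp
  qed
  have mono: "F s \<le> F s'" if "0 \<le> s" "s \<le> s'" for s s'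
    using pdf_on_halfline_integral_mono[OF f, of "{0..s}" "{0..s'}"] F that by auto
  show "F (min s s') = min (F s) (F s')" if "0 \<le> s" "0 \<le> s'" for s s'
    using mono[of s s'] mono[of s' s] that by (auto simp: min_def)
  have "continuous_on {0..} (\<lambda>s. LINT u:{0..s}|lborel. f u)"
    using pdf_on_halfline_set_integrable[OF f]
    by (intro continuous_on_subset[OF continuous_on_LBINT[of 0 f]]) auto
  then show "continuous_on {0..} F"
    by (rule continuous_on_eq) (simp add: F)
qed

section \<open>The Ornstein-Uhlenbeck field and the bridge\<close>

lemma exp_half_split:
  fixes x y :: real
  shows "exp (- x / 2 - y / 2) = exp (- x / 2) * exp (- y / 2)"
  by (simp flip: exp_add)

lemma exp_half_min:
  fixes a b :: real
  shows "exp (- a / 2) * exp (- b / 2) * min (exp a) (exp b) = exp (- (1/2) * \<bar>b - a\<bar>)"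
proof -
  have "exp (- a / 2) * exp (- b / 2) * min (exp a) (exp b) = exp (- a / 2 - b / 2 + min a b)"
    by (cases "a \<le> b") (simp_all add: min_def flip: exp_add)
  also have "- a / 2 - b / 2 + min a b = - (1/2) * \<bar>b - a\<bar>"
    by (auto simp: min_def abs_if field_simps)
  finally show ?thesis .
qed

lemma odds_min:
  fixes a b :: real
  assumes "a < 1" "b < 1"
  shows "(1 - a) * (1 - b) * min (a / (1 - a)) (b / (1 - b)) = min a b - a * b"
proof -
  have "a / (1 - a) \<le> b / (1 - b) \<longleftrightarrow> a \<le> b"
    using assms by (simp add: divide_simps algebra_simps)
  moreover have cancel: "(1 - x) * (1 - y) * (x / (1 - x)) = x - x * y" if "x < 1" for x y :: real
  proof -
    have "(1 - x) * (1 - y) * (x / (1 - x)) = (1 - y) * x"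
      using that by simp
    also have "\<dots> = x - x * y"
      by (simp add: algebra_simps)
    finally show ?thesis .
  qed
  ultimately show ?thesis
    using cancel[OF assms(1), of b] cancel[OF assms(2), of a]
    by (auto simp only: min_def mult.commute split: if_splits)
qed

lemma sqrt_mult_exp_half_log_odds:
  fixes a :: real
  assumes "0 < a" "a < 1"
  shows "sqrt (a * (1 - a)) * exp (- ln (a / (1 - a)) / 2) = 1 - a"
proof -
  have "exp (- ln (a / (1 - a)) / 2) = sqrt ((1 - a) / a)"
  proof -
    have "exp (- ln (a / (1 - a)) / 2) = exp (ln ((1 - a) / a) / 2)"
      using assms by (simp add: ln_div)
    also have "\<dots> = sqrt ((1 - a) / a)"
      using assms by (intro real_sqrt_unique[symmetric]) (auto simp: power2_eq_square simp flip: exp_add)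
    finally show ?thesis .
  qed
  moreover have "a * (1 - a) * ((1 - a) / a) = (1 - a)\<^sup>2"
    using assms by (simp add: power2_eq_square)
  ultimately show ?thesis
    using assms by (simp flip: real_sqrt_mult)
qed

lemma standard_wiener_field_vanishes_on_axes:
  assumes "prob_space M" and W: "standard_wiener_field M W"
  shows "AE \<omega> in M. \<forall>x\<ge>0. W (x, 0) \<omega> = 0 \<and> W (0, x) \<omega> = 0"
proof -
  have "closed ({0..} \<times> {0} \<union> {0} \<times> {0..} :: (real \<times> real) set)"
    by (intro closed_Un closed_Times) auto
  then have "AE \<omega> in M. \<forall>p \<in> {0..} \<times> {0} \<union> {0} \<times> {0..}. W p \<omega> = 0"
    using assms
    by (intro gauss_field_vanishes_on_closed[of M "{0..} \<times> {0..}"])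
       (auto simp: standard_wiener_field_def)
  then show ?thesis
    by eventually_elim auto
qed

lemma exponential_time_change_stationary_ou_field:
  assumes W: "standard_wiener_field M W"
    and X: "\<And>s t \<omega>. X (s, t) \<omega> = exp (- s / 2 - t / 2) * W (exp s, exp t) \<omega>"
  shows "stationary_ou_field M X"
proof -
  define c where "c = (\<lambda>(s, t). exp (- s / 2 - t / 2) :: real)"
  define h where "h = (\<lambda>(s, t). (exp s, exp t) :: real \<times> real)"
  have WG: "zero_mean_continuous_gauss_field M ({0..} \<times> {0..}) W"
    using W by (simp add: standard_wiener_field_def)
  then have measW: "W q \<in> borel_measurable M" if "q \<in> {0..} \<times> {0..}" for q
    using that by (auto simp: zero_mean_continuous_gauss_field_def gauss_field_def)
  have h: "h p \<in> {0..} \<times> {0..}" for p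
    by (auto simp: h_def split: prod.split)
  have XW: "X p = (\<lambda>\<omega>. c p * W (h p) \<omega>)" for p
    using X by (cases p) (auto simp: c_def h_def)
  have measX: "X p \<in> borel_measurable M" for p
    unfolding XW using measW[OF h] by measurable
  have "zero_mean_continuous_gauss_field M UNIV X"
    using measX h
    by (intro gauss_field_weighted_pullback[OF WG, of UNIV h c])
       (auto simp: XW c_def h_def case_prod_beta intro!: continuous_intros)
  moreover have "covariance M (X (s1, t1)) (X (s2, t2))
      = exp (- (1/2) * \<bar>s2 - s1\<bar> - (1/2) * \<bar>t2 - t1\<bar>)" for s1 t1 s2 t2
  proof -
    have "covariance M (X (s1, t1)) (X (s2, t2))
        = c (s1, t1) * c (s2, t2) * covariance M (W (h (s1, t1))) (W (h (s2, t2)))"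
      using measX h measW
      by (intro covariance_weighted_pullback[of "{0..} \<times> {0..}" W M UNIV]) (auto simp: XW)
    also have "\<dots> = (exp (- s1 / 2) * exp (- s2 / 2) * min (exp s1) (exp s2)) *
        (exp (- t1 / 2) * exp (- t2 / 2) * min (exp t1) (exp t2))"
      using W unfolding standard_wiener_field_def c_def h_def prod.case exp_half_split
      by (simp add: mult_ac)
    also have "\<dots> = exp (- (1/2) * \<bar>s2 - s1\<bar> - (1/2) * \<bar>t2 - t1\<bar>)"
      unfolding exp_half_min by (simp flip: exp_add)
    finally show ?thesis .
  qed
  ultimately show ?thesis
    by (simp add: stationary_ou_field_def)
qed

text \<open>
  Up to a null set of paths, the two cases for \<open>U\<close> are a single weighted pullback of \<open>W\<close>: the odds
  \<open>F s / (1 - F s)\<close> and \<open>G t / (1 - G t)\<close> send the axes to the axes, where \<open>W\<close> vanishes.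
\<close>

lemma odds_time_change_wiener_bridge:
  assumes "prob_space M" and W: "standard_wiener_field M W"
    and F: "F 0 = 0" "\<And>s. 0 < s \<Longrightarrow> 0 < F s"
      "\<And>s. 0 \<le> s \<Longrightarrow> ereal s < right_endpoint F \<Longrightarrow> F s < 1"
      "\<And>s s'. 0 \<le> s \<Longrightarrow> 0 \<le> s' \<Longrightarrow> F (min s s') = min (F s) (F s')"
      "continuous_on {0..} F"
    and G: "G 0 = 0" "\<And>t. 0 < t \<Longrightarrow> 0 < G t"
      "\<And>t. 0 \<le> t \<Longrightarrow> ereal t < right_endpoint G \<Longrightarrow> G t < 1"
      "\<And>t t'. 0 \<le> t \<Longrightarrow> 0 \<le> t' \<Longrightarrow> G (min t t') = min (G t) (G t')"
      "continuous_on {0..} G"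
    and interior: "\<And>s t \<omega>. 0 < s \<Longrightarrow> ereal s < right_endpoint F \<Longrightarrow>
        0 < t \<Longrightarrow> ereal t < right_endpoint G \<Longrightarrow>
        U (s, t) \<omega> = (1 - F s) * (1 - G t) * W (F s / (1 - F s), G t / (1 - G t)) \<omega>"
    and axes: "\<And>s t \<omega>. 0 \<le> s \<Longrightarrow> ereal s < right_endpoint F \<Longrightarrow>
        0 \<le> t \<Longrightarrow> ereal t < right_endpoint G \<Longrightarrow> s = 0 \<or> t = 0 \<Longrightarrow> U (s, t) \<omega> = 0"
  shows "wiener_bridge M F G U"
proof -
  define DS where "DS = {s. 0 \<le> s \<and> ereal s < right_endpoint F}"
  define DT where "DT = {t. 0 \<le> t \<and> ereal t < right_endpoint G}"
  define c where "c = (\<lambda>(s, t). (1 - F s) * (1 - G t))"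
  define h where "h = (\<lambda>(s, t). (F s / (1 - F s), G t / (1 - G t)))"
  have F_range: "0 \<le> F s" "F s < 1" if "s \<in> DS" for s
    using that F(1) F(2)[of s] F(3)[of s] by (auto simp: DS_def le_less)
  have G_range: "0 \<le> G t" "G t < 1" if "t \<in> DT" for t
    using that G(1) G(2)[of t] G(3)[of t] by (auto simp: DT_def le_less)
  have contF: "continuous_on DS F" and contG: "continuous_on DT G"
    using F(5) G(5) by (auto simp: DS_def DT_def elim!: continuous_on_subset)
  have contF2: "continuous_on (DS \<times> DT) (\<lambda>p. F (fst p))"
    by (rule continuous_on_compose2[OF contF]) (auto intro!: continuous_intros)
  have contG2: "continuous_on (DS \<times> DT) (\<lambda>p. G (snd p))"
    by (rule continuous_on_compose2[OF contG]) (auto intro!: continuous_intros)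
  have c: "continuous_on (DS \<times> DT) c"
    unfolding c_def case_prod_beta by (intro continuous_intros contF2 contG2)
  have h: "h p \<in> {0..} \<times> {0..}" if "p \<in> DS \<times> DT" for p
    using that F_range G_range by (force simp: h_def)
  have conth: "continuous_on (DS \<times> DT) h"
    unfolding h_def case_prod_beta
    using F_range(2) G_range(2) by (intro continuous_intros contF2 contG2) force+
  have WG: "zero_mean_continuous_gauss_field M ({0..} \<times> {0..}) W"
    using W by (simp add: standard_wiener_field_def)
  then have measW: "W q \<in> borel_measurable M" if "q \<in> {0..} \<times> {0..}" for q
    using that by (auto simp: zero_mean_continuous_gauss_field_def gauss_field_def)
  have U_int: "U p = (\<lambda>\<omega>. c p * W (h p) \<omega>)"
    if "p \<in> DS \<times> DT" "fst p \<noteq> 0" "snd p \<noteq> 0" for p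
    using that interior by (cases p) (auto simp: DS_def DT_def c_def h_def)
  have U_axes: "U p = (\<lambda>\<omega>. 0)" if "p \<in> DS \<times> DT" "fst p = 0 \<or> snd p = 0" for p
    using that axes by (cases p) (auto simp: DS_def DT_def)
  have measU: "U p \<in> borel_measurable M" if p: "p \<in> DS \<times> DT" for p
    using U_int[OF p] U_axes[OF p] measW[OF h[OF p]] by (cases "fst p = 0 \<or> snd p = 0") auto
  have UW: "AE \<omega> in M. \<forall>p\<in>DS \<times> DT. U p \<omega> = c p * W (h p) \<omega>"
    using standard_wiener_field_vanishes_on_axes[OF assms(1) W]
  proof eventually_elim
    case (elim \<omega>)
    show ?case
    proof
      fix p assume p: "p \<in> DS \<times> DT"
      show "U p \<omega> = c p * W (h p) \<omega>"
      proof (cases "fst p = 0 \<or> snd p = 0")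
        case True
        then have "fst (h p) = 0 \<or> snd (h p) = 0"
          using F(1) G(1) by (auto simp: h_def case_prod_beta)
        then have "W (h p) \<omega> = 0"
          using elim h[OF p] by (cases "h p") auto
        then show ?thesis
          using U_axes[OF p True] by simp
      next
        case False
        then show ?thesis
          using U_int[OF p] by simp
      qed
    qed
  qed
  have "zero_mean_continuous_gauss_field M (DS \<times> DT) U"
    by (rule gauss_field_weighted_pullback[OF WG h conth c measU UW])
  moreover have "covariance M (U (s1, t1)) (U (s2, t2))
      = (F (min s1 s2) - F s1 * F s2) * (G (min t1 t2) - G t1 * G t2)"
    if p: "(s1, t1) \<in> DS \<times> DT" and q: "(s2, t2) \<in> DS \<times> DT" for s1 t1 s2 t2
  proof -
    have "covariance M (U (s1, t1)) (U (s2, t2))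
        = c (s1, t1) * c (s2, t2) * covariance M (W (h (s1, t1))) (W (h (s2, t2)))"
      by (rule covariance_weighted_pullback[OF measW h measU UW p q])
    also have "covariance M (W (h (s1, t1))) (W (h (s2, t2)))
        = min (F s1 / (1 - F s1)) (F s2 / (1 - F s2)) * min (G t1 / (1 - G t1)) (G t2 / (1 - G t2))"
      using W h[OF p] h[OF q] by (simp add: standard_wiener_field_def h_def)
    also have "c (s1, t1) * c (s2, t2) * \<dots>
        = ((1 - F s1) * (1 - F s2) * min (F s1 / (1 - F s1)) (F s2 / (1 - F s2))) *
          ((1 - G t1) * (1 - G t2) * min (G t1 / (1 - G t1)) (G t2 / (1 - G t2)))"
      by (simp add: c_def)
    also have "\<dots> = (F (min s1 s2) - F s1 * F s2) * (G (min t1 t2) - G t1 * G t2)"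
      using p q F_range G_range F(4) G(4) by (simp add: odds_min DS_def DT_def)
    finally show ?thesis .
  qed
  ultimately show ?thesis
    unfolding wiener_bridge_def Let_def DS_def DT_def by blast
qed

theorem proposition4p1:
  fixes M :: "'w measure"
    and f g F G :: "real \<Rightarrow> real"
    and S T :: ereal
    and \<delta>1 \<delta>2 :: real
    and W X U :: "real \<times> real \<Rightarrow> 'w \<Rightarrow> real"
  assumes "prob_space M"
    and "pdf_on_halfline f" and "pdf_on_halfline g"
    and "\<And>s. 0 \<le> s \<Longrightarrow> F s = (LINT u:{0..s}|lborel. f u)"
    and "\<And>t. 0 \<le> t \<Longrightarrow> G t = (LINT u:{0..t}|lborel. g u)"
    and "S = right_endpoint F" and "T = right_endpoint G"
    and "continuous_on {s. 0 \<le> s \<and> ereal s < S} f"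
    and "continuous_on {t. 0 \<le> t \<and> ereal t < T} g"
    and "0 < \<delta>1" and "ereal \<delta>1 < S" and "\<And>t. 0 < t \<Longrightarrow> t < \<delta>1 \<Longrightarrow> f t \<noteq> 0"
    and "0 < \<delta>2" and "ereal \<delta>2 < T" and "\<And>t. 0 < t \<Longrightarrow> t < \<delta>2 \<Longrightarrow> g t \<noteq> 0"
    and "standard_wiener_field M W"
    and "\<And>s t \<omega>. X (s, t) \<omega> = exp (- s / 2 - t / 2) * W (exp s, exp t) \<omega>"
    and "\<And>s t \<omega>. 0 < s \<Longrightarrow> ereal s < S \<Longrightarrow> 0 < t \<Longrightarrow> ereal t < T \<Longrightarrow>
           U (s, t) \<omega> = sqrt (F s * (1 - F s) * G t * (1 - G t)) *
             X (ln (F s / (1 - F s)), ln (G t / (1 - G t))) \<omega>"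
    and "\<And>s t \<omega>. 0 \<le> s \<Longrightarrow> ereal s < S \<Longrightarrow> 0 \<le> t \<Longrightarrow> ereal t < T \<Longrightarrow> s = 0 \<or> t = 0 \<Longrightarrow>
           U (s, t) \<omega> = 0"
  shows "stationary_ou_field M X \<and> wiener_bridge M F G U"
proof (intro conjI)
  note propF = distribution_function_properties[OF assms(2) assms(4) assms(10,12)]
  note propG = distribution_function_properties[OF assms(3) assms(5) assms(13,15)]
  show "stationary_ou_field M X"
    using assms(16,17) by (rule exponential_time_change_stationary_ou_field)
  have "U (s, t) \<omega> = (1 - F s) * (1 - G t) * W (F s / (1 - F s), G t / (1 - G t)) \<omega>"
    if st: "0 < s" "ereal s < S" "0 < t" "ereal t < T" for s t \<omega>
  proof -
    let ?a = "F s / (1 - F s)" and ?b = "G t / (1 - G t)"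
    have F: "0 < F s" "F s < 1" and G: "0 < G t" "G t < 1"
      using propF(2,3)[of s] propG(2,3)[of t] st assms(6,7) by auto
    have exp_odds: "exp (ln ?a) = ?a" "exp (ln ?b) = ?b"
      using F G by simp_all
    have "U (s, t) \<omega> = sqrt ((F s * (1 - F s)) * (G t * (1 - G t))) *
        (exp (- ln ?a / 2 - ln ?b / 2) * W (exp (ln ?a), exp (ln ?b)) \<omega>)"
      by (simp only: assms(17) assms(18)[OF st] mult.assoc)
    also have "\<dots> = (sqrt (F s * (1 - F s)) * exp (- ln ?a / 2)) *
        (sqrt (G t * (1 - G t)) * exp (- ln ?b / 2)) * W (?a, ?b) \<omega>"
      by (simp only: exp_half_split real_sqrt_mult exp_odds mult_ac)
    finally show ?thesis
      using F G by (simp only: sqrt_mult_exp_half_log_odds)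
  qed
  then show "wiener_bridge M F G U"
    using assms(6,7,19)
    by (intro odds_time_change_wiener_bridge[OF assms(1,16) propF propG]) auto
qed

end
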